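(* Assume that the cardinal $\mathfrak{c}$ is regular. Let $\mathcal{A}=\{A_\xi:\xi<\mathfrak{c}\}$ be a family of nonempty subsets of $\mathbb{R}$ such that: (i) $|\mathbb{R}\setminus\bigcup_{\eta<\xi}A_\eta|=\mathfrak{c}$ for every $\xi<\mathfrak{c}$, and (ii) $\mathbb{R}=\bigcup_{\xi<\mathfrak{c}}A_\xi$. Then there is a weak selection $f$ on $\mathbb{R}$ such that $\mathcal{N}_f=[\mathbb{R}]^{<\mathfrak{c}}\oplus\mathcal{I}(\mathcal{A})$.
   Context: A weak selection on $\mathbb{R}$ is a function $f:[\mathbb{R}]^2\to\mathbb{R}$ with $f(F)\in F$ for every two-element set $F\subseteq\mathbb{R}$. For distinct $x,y$ write $x<_f y$ if $f(\{x,y\})=x$, and $x\leq_f y$ if $x<_f y$ or $x=y$. For $r,s\in\mathbb{R}$, $(r,s]_f=\{x\in\mathbb{R}: r<_f x\leq_f s\}$ (it is not required that $r<_f s$). For $A\subseteq\mathbb{R}$, $\lambda_f(A)=\inf\{\sum_{n\in\mathbb{N}}|s_n-r_n| : A\subseteq\bigcup_{n\in\mathbb{N}}(r_n,s_n]_f\}$ if $A$ can be covered by countably many intervals $(r,s]_f$, and $\lambda_f(A)=+\infty$ otherwise. $\mathcal{N}_f=\{A\subseteq\mathbb{R}:\lambda_f(A)=0\}$. $\mathfrak{c}$ is the cardinality of $\mathbb{R}$, and $[\mathbb{R}]^{<\mathfrak{c}}$ is the family of subsets of $\mathbb{R}$ of cardinality less than $\mathfrak{c}$. For a nonempty family $\mathcal{A}$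 of nonempty subsets of $\mathbb{R}$, $\mathcal{I}(\mathcal{A})$ is the $\sigma$-ideal generated by $\mathcal{A}$ together with the countable sets: $X\in\mathcal{I}(\mathcal{A})$ iff $X\subseteq C\cup\bigcup\mathcal{A}'$ for some countable $\mathcal{A}'\subseteq\mathcal{A}$ and some countable $C\subseteq\mathbb{R}$. For ideals $\mathcal{I},\mathcal{J}$, $\mathcal{I}\oplus\mathcal{J}=\{I\cup J: I\in\mathcal{I}, J\in\mathcal{J}\}$. *)

theory Defs
  imports "HOL-Analysis.Analysis"
begin

unbundle cardinal_syntax

(* A function on the two-element subsets of the reals is represented by a total function on
   sets of reals; its values on other sets are never used. *)
definition weak_selection :: "(real set \<Rightarrow> real) \<Rightarrow> bool" where
  "weak_selection f \<longleftrightarrow> (\<forall>F. card F = 2 \<longrightarrow> f F \<in> F)"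

definition sel_less :: "(real set \<Rightarrow> real) \<Rightarrow> real \<Rightarrow> real \<Rightarrow> bool" where
  "sel_less f x y \<longleftrightarrow> x \<noteq> y \<and> f {x, y} = x"

definition sel_le :: "(real set \<Rightarrow> real) \<Rightarrow> real \<Rightarrow> real \<Rightarrow> bool" where
  "sel_le f x y \<longleftrightarrow> sel_less f x y \<or> x = y"

definition sel_Ioc :: "(real set \<Rightarrow> real) \<Rightarrow> real \<Rightarrow> real \<Rightarrow> real set" where
  "sel_Ioc f r s = {x. sel_less f r x \<and> sel_le f x s}"

(* The infimum of the empty set is \<infinity> in ennreal, so sets without a countable cover
   get the value \<infinity>. *)
definition sel_outer :: "(real set \<Rightarrow> real) \<Rightarrow> real set \<Rightarrow> ennreal" where
  "sel_outer f A =
     Inf {(\<Sum>n. ennreal \<bar>s n - r n\<bar>) | (r :: nat \<Rightarrow> real) (s :: nat \<Rightarrow> real).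
            A \<subseteq> (\<Union>n. sel_Ioc f (r n) (s n))}"

definition sel_null :: "(real set \<Rightarrow> real) \<Rightarrow> real set set" where
  "sel_null f = {A. sel_outer f A = 0}"

definition small_sets :: "real set set" where
  "small_sets = {X. |X| <o |UNIV :: real set|}"

definition gen_sigma_ideal :: "real set set \<Rightarrow> real set set" where
  "gen_sigma_ideal \<A> =
     {X. \<exists>\<B> C. \<B> \<subseteq> \<A> \<and> countable \<B> \<and> countable C \<and> X \<subseteq> C \<union> \<Union>\<B>}"

definition ideal_sum :: "real set set \<Rightarrow> real set set \<Rightarrow> real set set" where
  "ideal_sum \<I> \<J> = {I \<union> J | I J. I \<in> \<I> \<and> J \<in> \<J>}"

end

theory Submission
  imports Defs
begin

text \<open>
  Well-order the reals in type \<open>\<cc>\<close> and call a point late if it comes after everything in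
  question; since \<open>\<cc>\<close> is regular, every set of fewer than \<open>\<cc>\<close> reals lies in a proper initial
  segment. A weak selection is a tournament, and it can be fixed by deciding, for each real
  \<open>x\<close>, how \<open>x\<close> compares with the earlier points. The default rule is extreme: \<open>x\<close> lies below all
  earlier points if \<open>\<lfloor>x\<rfloor>\<close> is even, and above all of them if \<open>\<lfloor>x\<rfloor>\<close> is odd. Under this rule an
  interval \<open>(r, s]\<^sub>f\<close> contains no point later than both \<open>r\<close> and \<open>s\<close>, so any countably coverable
  set is small.

  To make the generators null, each index \<open>\<xi>\<close> receives a marker \<open>z + e \<xi>\<close> in every unit interval
  \<open>[z, z + 1)\<close>, where \<open>e\<close> is an injection into the irrationals of \<open>(0, 1)\<close>. A point \<open>x\<close> of
  \<open>A \<xi>\<close> reverses the default rule at one point for the sake of \<open>\<xi>\<close>, namely at the marker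
  of \<open>\<xi>\<close> in the unit interval of \<open>x\<close>. The points of \<open>A \<xi>\<close> in \<open>[z, z + 1)\<close> then lie, as soon as
  they are late enough, between the marker and any rational \<open>q\<close>, which is never a
  marker; choosing \<open>q\<close> close to the marker makes the interval short
  (\<open>generator_slice_null\<close>). Conversely, a point later than both endpoints of an
  interval belongs to it only if an endpoint is a marker of some \<open>\<xi>\<close> with \<open>x \<in> A \<xi>\<close>
  (\<open>late_in_sel_Ioc\<close>). A real marks at most one index, so a countable cover involves only
  countably many generators and a small set of points that are not late
  (\<open>covered_imp_ideal\<close>).

  Finally, a small set has to be null. It precedes some \<open>p\<close> just below an odd integer
  and some \<open>q\<close> just above it. By the default rule \<open>p\<close> is below and \<open>q\<close> is above all earlier points,
  so \<open>(p, q]\<^sub>f\<close> covers the small set except for markers in the unit intervals of \<open>p\<close> and \<open>q\<close>.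
  Using two different odd integers takes care of these (\<open>small_avoiding_null\<close>, \<open>small_null\<close>).
\<close>

section \<open>Weak selections from tournaments\<close>

definition tournament_selection :: "(real \<Rightarrow> real \<Rightarrow> bool) \<Rightarrow> real set \<Rightarrow> real" where
  "tournament_selection lt F = (SOME a. a \<in> F \<and> (\<forall>b\<in>F - {a}. lt a b))"

lemma tournament_selection_pair:
  assumes "x \<noteq> y" "lt x y" "\<not> lt y x"
  shows "tournament_selection lt {x, y} = x"
  unfolding tournament_selection_def
  by (rule some_equality) (use assms in auto)

context
  fixes lt :: "real \<Rightarrow> real \<Rightarrow> bool"
  assumes tournament: "\<And>x y. x \<noteq> y \<Longrightarrow> lt x y \<longleftrightarrow> \<not> lt y x"
begin

lemma sel_less_tournament_selection:
  "sel_less (tournament_selection lt) x y \<longleftrightarrow> x \<noteq> y \<and> lt x y"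
proof (cases "x = y")
  case False
  then consider "lt x y" "\<not> lt y x" | "lt y x" "\<not> lt x y"
    using tournament by blast
  then show ?thesis
  proof cases
    case 1
    then show ?thesis
      using False tournament_selection_pair[of x y lt] by (simp add: sel_less_def)
  next
    case 2
    then show ?thesis
      using False tournament_selection_pair[of y x lt]
      by (simp add: sel_less_def insert_commute)
  qed
qed (simp add: sel_less_def)

lemma weak_selection_tournament_selection: "weak_selection (tournament_selection lt)"
  unfolding weak_selection_def
proof (intro allI impI)
  fix F :: "real set"
  assume "card F = 2"
  then obtain x y where F: "F = {x, y}" "x \<noteq> y"
    by (meson card_2_iff)
  then consider "lt x y" "\<not> lt y x" | "lt y x" "\<not> lt x y"
    using tournament by blast
  then show "tournament_selection lt F \<in> F"
  proof cases
    case 1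
    then show ?thesis
      using F tournament_selection_pair[of x y lt] by simp
  next
    case 2
    then show ?thesis
      using F tournament_selection_pair[of y x lt] by (simp add: insert_commute)
  qed
qed

end

section \<open>Null sets of a weak selection\<close>

lemma sel_null_iff:
  "X \<in> sel_null f \<longleftrightarrow>
     (\<forall>\<epsilon>>0. \<exists>r s. X \<subseteq> (\<Union>n. sel_Ioc f (r n) (s n)) \<and> (\<Sum>n. ennreal \<bar>s n - r n\<bar>) < \<epsilon>)"
proof -
  have "X \<in> sel_null f \<longleftrightarrow> (\<forall>\<epsilon>>0. sel_outer f X < \<epsilon>)"
    unfolding sel_null_def by (auto simp: zero_less_iff_neq_zero)
  moreover have "sel_outer f X < \<epsilon> \<longleftrightarrow>
      (\<exists>r s. X \<subseteq> (\<Union>n. sel_Ioc f (r n) (s n)) \<and> (\<Sum>n. ennreal \<bar>s n - r n\<bar>) < \<epsilon>)" for \<epsilon>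
    unfolding sel_outer_def Inf_less_iff by blast
  ultimately show ?thesis
    by simp
qed

lemma sel_null_subset: "X \<in> sel_null f \<Longrightarrow> Y \<subseteq> X \<Longrightarrow> Y \<in> sel_null f"
  unfolding sel_null_iff by (meson order_trans)

lemma ennreal_pos_real_below:
  fixes \<epsilon> :: ennreal
  assumes "\<epsilon> > 0"
  obtains \<delta> :: real where "\<delta> > 0" "ennreal \<delta> < \<epsilon>"
proof -
  obtain x where x: "0 < x" "x < \<epsilon>"
    using dense[OF assms] by blast
  then show ?thesis
    using that[of "enn2real x"] by (cases x) auto
qed

text \<open>
  The cover must be a sequence; degenerate intervals of length zero fill it up.
\<close>

lemma sel_null_if_single_intervals:
  assumes "\<And>\<epsilon>::real. \<epsilon> > 0 \<Longrightarrow> \<exists>r s. \<bar>s - r\<bar> < \<epsilon> \<and> X \<subseteq> sel_Ioc f r s"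
  shows "X \<in> sel_null f"
  unfolding sel_null_iff
proof (intro allI impI)
  fix \<epsilon> :: ennreal
  assume "\<epsilon> > 0"
  then obtain \<delta> :: real where \<delta>: "\<delta> > 0" "ennreal \<delta> < \<epsilon>"
    by (rule ennreal_pos_real_below)
  obtain r s where rs: "\<bar>s - r\<bar> < \<delta>" "X \<subseteq> sel_Ioc f r s"
    using assms[OF \<delta>(1)] by blast
  let ?s = "\<lambda>n::nat. if n = 0 then s else r"
  have "(\<Sum>n. ennreal \<bar>?s n - r\<bar>) = (\<Sum>n\<in>{0}. ennreal \<bar>?s n - r\<bar>)"
    by (rule suminf_finite) auto
  also have "\<dots> < \<epsilon>"
    using rs(1) \<delta> by (simp add: ennreal_leI order_le_less_trans[of _ "ennreal \<delta>"])
  finally have "(\<Sum>n. ennreal \<bar>?s n - r\<bar>) < \<epsilon>" .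
  moreover have "X \<subseteq> (\<Union>n. sel_Ioc f r (?s n))"
    using rs(2) by force
  ultimately show "\<exists>r s. X \<subseteq> (\<Union>n. sel_Ioc f (r n) (s n)) \<and> (\<Sum>n. ennreal \<bar>s n - r n\<bar>) < \<epsilon>"
    by (intro exI[of _ "\<lambda>_. r"] exI[of _ ?s] conjI)
qed

text \<open>
  The covers of the \<open>X n\<close> with lengths below \<open>\<delta> / 2 ^ (n + 1)\<close> are
  rearranged into a single sequence by the pairing function.
\<close>

lemma sel_null_UN_nat:
  assumes "\<And>n::nat. X n \<in> sel_null f"
  shows "(\<Union>n. X n) \<in> sel_null f"
  unfolding sel_null_iff
proof (intro allI impI)
  fix \<epsilon> :: ennreal
  assume "\<epsilon> > 0"
  then obtain \<delta> :: real where \<delta>: "\<delta> > 0" "ennreal \<delta> < \<epsilon>"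
    by (rule ennreal_pos_real_below)
  have "\<forall>n. \<exists>r s. X n \<subseteq> (\<Union>m. sel_Ioc f (r m) (s m)) \<and>
          (\<Sum>m. ennreal \<bar>s m - r m\<bar>) < ennreal (\<delta> * (1/2) ^ Suc n)"
  proof
    fix n
    have "ennreal (\<delta> * (1/2) ^ Suc n) > 0"
      using \<delta>(1) by simp
    then show "\<exists>r s. X n \<subseteq> (\<Union>m. sel_Ioc f (r m) (s m)) \<and>
          (\<Sum>m. ennreal \<bar>s m - r m\<bar>) < ennreal (\<delta> * (1/2) ^ Suc n)"
      using assms[of n] unfolding sel_null_iff by blast
  qed
  then have "\<exists>r s. \<forall>n. X n \<subseteq> (\<Union>m. sel_Ioc f (r n m) (s n m)) \<and>
          (\<Sum>m. ennreal \<bar>s n m - r n m\<bar>) < ennreal (\<delta> * (1/2) ^ Suc n)"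
    unfolding choice_iff .
  then obtain r s where rs: "\<forall>n. X n \<subseteq> (\<Union>m. sel_Ioc f (r n m) (s n m)) \<and>
          (\<Sum>m. ennreal \<bar>s n m - r n m\<bar>) < ennreal (\<delta> * (1/2) ^ Suc n)"
    by (elim exE)
  have cover: "X n \<subseteq> (\<Union>m. sel_Ioc f (r n m) (s n m))"
    and len: "(\<Sum>m. ennreal \<bar>s n m - r n m\<bar>) < ennreal (\<delta> * (1/2) ^ Suc n)" for n
    using spec[OF rs, of n] by (rule conjunct1, rule conjunct2)
  let ?r = "\<lambda>k. r (fst (prod_decode k)) (snd (prod_decode k))"
  let ?s = "\<lambda>k. s (fst (prod_decode k)) (snd (prod_decode k))"
  have "(\<Sum>k. ennreal \<bar>?s k - ?r k\<bar>) = (\<Sum>n. \<Sum>m. ennreal \<bar>s n m - r n m\<bar>)"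
    by (rule suminf_ennreal_2dimen[where f = "\<lambda>p. ennreal \<bar>s (fst p) (snd p) - r (fst p) (snd p)\<bar>"])
      (simp only: fst_conv snd_conv)
  also have "\<dots> \<le> (\<Sum>n. ennreal (\<delta> * (1/2) ^ Suc n))"
    by (intro suminf_le less_imp_le[OF len] summableI)
  also have "\<dots> = ennreal \<delta>"
    using sums_mult[OF power_half_series, of \<delta>] \<delta>(1)
    by (intro suminf_ennreal_eq) auto
  finally have "(\<Sum>k. ennreal \<bar>?s k - ?r k\<bar>) < \<epsilon>"
    using \<delta>(2) by simp
  moreover have "(\<Union>n. X n) \<subseteq> (\<Union>k. sel_Ioc f (?r k) (?s k))"
  proof
    fix x
    assume "x \<in> (\<Union>n. X n)"
    then obtain n m where "x \<in> sel_Ioc f (r n m) (s n m)"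
      using cover by blast
    then show "x \<in> (\<Union>k. sel_Ioc f (?r k) (?s k))"
      by (intro UN_I[of "prod_encode (n, m)"]) auto
  qed
  ultimately show "\<exists>r s. (\<Union>n. X n) \<subseteq> (\<Union>n. sel_Ioc f (r n) (s n)) \<and>
                     (\<Sum>n. ennreal \<bar>s n - r n\<bar>) < \<epsilon>"
    by (intro exI[of _ ?r] exI[of _ ?s] conjI)
qed

lemma sel_null_empty: "{} \<in> sel_null f"
  by (rule sel_null_if_single_intervals) (intro exI[of _ "0::real"], simp)

lemma sel_null_UN:
  assumes "countable I" "\<And>i. i \<in> I \<Longrightarrow> X i \<in> sel_null f"
  shows "(\<Union>i\<in>I. X i) \<in> sel_null f"
proof (cases "I = {}")
  case False
  then have "(\<Union>n. X (from_nat_into I n)) \<in> sel_null f"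
    by (intro sel_null_UN_nat assms(2) from_nat_into)
  then show ?thesis
    by (rule sel_null_subset) (use assms(1) in \<open>fastforce intro: subset_range_from_nat_into dest: from_nat_into_surj\<close>)
qed (simp add: sel_null_empty)

lemma sel_null_Un: "X \<in> sel_null f \<Longrightarrow> Y \<in> sel_null f \<Longrightarrow> X \<union> Y \<in> sel_null f"
  using sel_null_UN[of "{X, Y}" "\<lambda>x. x" f] by auto

section \<open>Small sets of reals\<close>

lemma small_sets_mono: "S \<in> small_sets \<Longrightarrow> T \<subseteq> S \<Longrightarrow> T \<in> small_sets"
  unfolding small_sets_def using card_of_mono1 ordLeq_ordLess_trans by blast

lemma small_sets_Un: "S \<in> small_sets \<Longrightarrow> T \<in> small_sets \<Longrightarrow> S \<union> T \<in> small_sets"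
  unfolding small_sets_def
  by (simp add: card_of_Un_ordLess_infinite[OF infinite_UNIV_char_0])

lemma countable_imp_small:
  assumes "countable C"
  shows "C \<in> small_sets"
proof -
  have "\<not> |UNIV :: real set| \<le>o |C|"
  proof
    assume "|UNIV :: real set| \<le>o |C|"
    then obtain g :: "real \<Rightarrow> real" where g: "inj g" "range g \<subseteq> C"
      unfolding card_of_ordLeq[symmetric] by (elim exE conjE)
    have "countable (UNIV :: real set)"
      using countable_subset[OF g(2) assms] g(1) by (rule countable_image_inj_on)
    then show False
      using uncountable_UNIV_real by contradiction
  qed
  then have "|C| <o |UNIV :: real set|"
    by (rule iffD1[OF not_ordLeq_iff_ordLess[OF card_of_Well_order card_of_Well_order]])
  then show ?thesis
    by (simp add: small_sets_def)
qed

text \<open>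
  Two uses: the irrationals of \<open>(0, 1)\<close> can be indexed by \<open>\<kappa>\<close>, and every interval contains
  points outside any given initial segment of the well-order.
\<close>

lemma interval_minus_small_sets:
  assumes "a < b" "S \<in> small_sets"
  shows "|{a<..<b} - S| =o |UNIV :: real set|"
proof -
  have ab: "|{a<..<b}| =o |UNIV :: real set|"
    using assms(1) open_interval_eqpoll_reals eqpoll_iff_card_of_ordIso by blast
  have "\<not> |{a<..<b} - S| <o |UNIV :: real set|"
  proof
    assume "|{a<..<b} - S| <o |UNIV :: real set|"
    then have "({a<..<b} - S) \<union> S \<in> small_sets"
      using assms(2) by (intro small_sets_Un) (auto simp: small_sets_def)
    then have "{a<..<b} \<in> small_sets"
      by (rule small_sets_mono) blast
    then show False
      using ab not_ordLess_ordIso unfolding small_sets_def by blast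
  qed
  moreover have "|{a<..<b} - S| \<le>o |UNIV :: real set|"
    by (rule card_of_mono1) simp
  ultimately show ?thesis
    using ordLeq_iff_ordLess_or_ordIso by blast
qed

lemma interval_not_small:
  assumes "a < b" "S \<in> small_sets"
  obtains x where "a < x" "x < b" "x \<notin> S"
proof -
  have "infinite ({a<..<b} - S)"
    using card_of_ordIso_finite[OF interval_minus_small_sets[OF assms]]
    by (simp add: infinite_UNIV_char_0)
  then obtain x where "x \<in> {a<..<b} - S"
    using infinite_imp_nonempty by blast
  then show ?thesis
    using that[of x] by simp
qed

lemma initial_segment_small: "underS |UNIV :: real set| \<delta> \<in> small_sets"
  unfolding small_sets_def
  using card_of_underS[OF card_of_Card_order, of \<delta> UNIV] by (simp add: Field_card_of)

text \<open>
  By regularity, the set is not cofinal. Since an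
  infinite cardinal is a limit, the bound can be moved one step up to become strict.
\<close>

lemma small_sets_bounded:
  assumes "regularCard |UNIV :: real set|" "S \<in> small_sets"
  shows "\<exists>\<delta>. S \<subseteq> underS |UNIV :: real set| \<delta>"
proof -
  let ?W = "|UNIV :: real set|"
  have "\<not> cofinal S ?W"
    using assms not_ordLess_ordIso unfolding regularCard_def small_sets_def Field_card_of by blast
  then obtain a where a: "\<And>b. b \<in> S \<Longrightarrow> a = b \<or> (a, b) \<notin> ?W"
    unfolding cofinal_def by auto
  have lin: "total ?W" "antisym ?W" "trans ?W" "refl ?W"
    using card_of_Well_order[of "UNIV :: real set"] unfolding order_on_defs Field_card_of by auto
  have "\<exists>\<delta>\<in>Field ?W. a \<noteq> \<delta> \<and> (a, \<delta>) \<in> ?W"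
    by (rule infinite_Card_order_limit[OF card_of_Card_order])
      (simp_all add: Field_card_of infinite_UNIV_char_0)
  then obtain \<delta> where \<delta>: "a \<noteq> \<delta>" "(a, \<delta>) \<in> ?W"
    by (elim bexE conjE)
  have "b \<in> underS ?W \<delta>" if "b \<in> S" for b
  proof -
    have ba: "(b, a) \<in> ?W"
      using a[OF that] lin(1)[unfolded total_on_def, rule_format, of a b] reflD[OF lin(4), of a] by blast
    then have "(b, \<delta>) \<in> ?W"
      using \<delta>(2) by (rule transD[OF lin(3)])
    moreover have "b \<noteq> \<delta>"
      using ba \<delta> antisymD[OF lin(2), of a b] by blast
    ultimately show ?thesis
      by (simp add: underS_def)
  qed
  then show ?thesis
    by blast
qed

section \<open>The selection\<close>

locale marked_selection =
  fixes I :: "'i set" and A :: "'i \<Rightarrow> real set" and e :: "'i \<Rightarrow> real"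
  assumes regular: "regularCard |UNIV :: real set|"
    and inj_e: "inj_on e I"
    and e_irrational: "e ` I \<subseteq> {0<..<1} - \<rat>"
begin

text \<open>
  The markers, in the unit interval of \<open>x\<close>, of the indices \<open>\<xi>\<close> with \<open>x \<in> A \<xi>\<close>: the reals of the
  form \<open>\<lfloor>x\<rfloor> + e \<xi>\<close>. They all share the floor of \<open>x\<close>, so points in different unit
  intervals have disjoint exceptions.
\<close>

definition exceptions :: "real \<Rightarrow> real set" where
  "exceptions x = {y. \<lfloor>y\<rfloor> = \<lfloor>x\<rfloor> \<and> (\<exists>\<xi>\<in>I. x \<in> A \<xi> \<and> frac y = e \<xi>)}"

abbreviation earlier :: "real \<Rightarrow> real set" where
  "earlier \<equiv> underS |UNIV :: real set|"

text \<open>Only meaningful when \<open>y\<close> is earlier than \<open>x\<close>.\<close>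

definition above :: "real \<Rightarrow> real \<Rightarrow> bool" where
  "above x y \<longleftrightarrow> odd \<lfloor>x\<rfloor> \<noteq> (y \<in> exceptions x)"

definition lt :: "real \<Rightarrow> real \<Rightarrow> bool" where
  "lt x y \<longleftrightarrow> (if y \<in> earlier x then \<not> above x y else above y x)"

definition sel :: "real set \<Rightarrow> real" where
  "sel = tournament_selection lt"

lemma earlier_irrefl: "x \<notin> earlier x"
  by (simp add: underS_def)

lemma earlier_total:
  assumes "x \<noteq> y"
  shows "x \<in> earlier y \<longleftrightarrow> y \<notin> earlier x"
proof -
  have "total |UNIV :: real set|" "antisym |UNIV :: real set|"
    using card_of_Well_order[of "UNIV :: real set"] unfolding order_on_defs Field_card_of by auto
  then show ?thesis
    using assms unfolding underS_def total_on_def antisym_def by blast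
qed

lemma earlier_trans:
  assumes "x \<in> earlier y" "y \<in> earlier z"
  shows "x \<in> earlier z"
proof -
  have "trans |UNIV :: real set|" "antisym |UNIV :: real set|"
    using card_of_Well_order[of "UNIV :: real set"] unfolding order_on_defs Field_card_of by auto
  then show ?thesis
    using assms unfolding underS_def
    by (smt (verit) antisymD mem_Collect_eq transD)
qed

lemma earlier_if_late: "x \<in> earlier \<delta> \<Longrightarrow> y \<notin> earlier \<delta> \<Longrightarrow> x \<in> earlier y"
  using earlier_total earlier_trans by metis

lemma lt_tournament: "x \<noteq> y \<Longrightarrow> lt x y \<longleftrightarrow> \<not> lt y x"
  using earlier_total[of x y] by (cases "x \<in> earlier y") (simp_all add: lt_def)

lemma weak_selection_sel: "weak_selection sel"
  unfolding sel_def by (rule weak_selection_tournament_selection) (rule lt_tournament)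

lemma sel_less_sel: "sel_less sel x y \<longleftrightarrow> x \<noteq> y \<and> lt x y"
  unfolding sel_def by (rule sel_less_tournament_selection) (rule lt_tournament)

lemma sel_less_earlier:
  assumes "y \<in> earlier x"
  shows "sel_less sel y x \<longleftrightarrow> above x y" and "sel_less sel x y \<longleftrightarrow> \<not> above x y"
proof -
  have "x \<noteq> y" "x \<notin> earlier y"
    using assms earlier_irrefl earlier_trans by blast+
  then show "sel_less sel y x \<longleftrightarrow> above x y" "sel_less sel x y \<longleftrightarrow> \<not> above x y"
    using assms by (auto simp: sel_less_sel lt_def)
qed

text \<open>
  Being above \<open>r\<close> and below \<open>s\<close> contradicts the default rule of \<open>x\<close> at one of the endpoints.
\<close>

lemma late_in_sel_Ioc:
  assumes "r \<in> earlier x" "s \<in> earlier x" "x \<in> sel_Ioc sel r s"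
  shows "\<exists>\<xi>\<in>I. x \<in> A \<xi> \<and> e \<xi> \<in> {frac r, frac s}"
proof -
  have "x \<noteq> s"
    using assms(2) earlier_irrefl by blast
  then have "above x r" "\<not> above x s"
    using assms sel_less_earlier by (auto simp: sel_Ioc_def sel_le_def)
  then have "r \<in> exceptions x \<or> s \<in> exceptions x"
    by (auto simp: above_def)
  then show ?thesis
    by (auto simp: exceptions_def)
qed

text \<open>
  All endpoints lie before some \<open>\<delta>\<close>, which leaves a small part of \<open>X\<close>. The rest is covered by
  the generators that have an endpoint as a marker, and injectivity of \<open>e\<close> makes these countably
  many.
\<close>

lemma covered_imp_ideal:
  assumes "X \<subseteq> (\<Union>n::nat. sel_Ioc sel (r n) (s n))"
  shows "X \<in> ideal_sum small_sets (gen_sigma_ideal (A ` I))"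
proof -
  let ?C = "range r \<union> range s"
  obtain \<delta> where \<delta>: "?C \<subseteq> earlier \<delta>"
    using small_sets_bounded[OF regular countable_imp_small, of ?C] by auto
  define J where "J = {\<xi> \<in> I. e \<xi> \<in> frac ` ?C}"
  have "countable (e ` J)"
    by (rule countable_subset[of _ "frac ` ?C"]) (auto simp: J_def)
  then have J: "countable J" "J \<subseteq> I"
    using inj_e by (auto simp: J_def intro: countable_image_inj_on inj_on_subset)
  have "X - earlier \<delta> \<subseteq> (\<Union>\<xi>\<in>J. A \<xi>)"
  proof
    fix x
    assume x: "x \<in> X - earlier \<delta>"
    then obtain n where "x \<in> sel_Ioc sel (r n) (s n)"
      using assms by blast
    moreover have "r n \<in> earlier x" "s n \<in> earlier x"
      using \<delta> x earlier_if_late by blast+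
    ultimately have "\<exists>\<xi>\<in>I. x \<in> A \<xi> \<and> e \<xi> \<in> {frac (r n), frac (s n)}"
      by (intro late_in_sel_Ioc)
    then obtain \<xi> where \<xi>: "\<xi> \<in> I" "x \<in> A \<xi>" "e \<xi> \<in> {frac (r n), frac (s n)}"
      by (elim bexE conjE)
    then have "\<xi> \<in> J"
      by (auto simp: J_def)
    then show "x \<in> (\<Union>\<xi>\<in>J. A \<xi>)"
      using \<xi>(2) by (rule UN_I)
  qed
  then have "X - earlier \<delta> \<in> gen_sigma_ideal (A ` I)"
    unfolding gen_sigma_ideal_def using J
    by (intro CollectI exI[of _ "A ` J"] exI[of _ "{}"]) auto
  moreover have "X \<inter> earlier \<delta> \<in> small_sets"
    using initial_segment_small by (rule small_sets_mono) blast
  moreover have "X = (X \<inter> earlier \<delta>) \<union> (X - earlier \<delta>)"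
    by blast
  ultimately show ?thesis
    unfolding ideal_sum_def by blast
qed

lemma marker_floor_frac: "\<xi> \<in> I \<Longrightarrow> \<lfloor>real_of_int z + e \<xi>\<rfloor> = z \<and> frac (real_of_int z + e \<xi>) = e \<xi>"
  using e_irrational by (auto simp: frac_def floor_eq_iff)

text \<open>
  Rationals are dense and never markers, so they serve as the other endpoint of short
  intervals with a marker as one endpoint.
\<close>

lemma rational_not_exception: "q \<in> \<rat> \<Longrightarrow> q \<notin> exceptions x"
  using e_irrational unfolding exceptions_def frac_def
  by (smt (verit, best) DiffD2 Rats_diff Rats_of_int image_subset_iff mem_Collect_eq)

text \<open>
  Late points of the slice reverse their default rule at the marker \<open>?d\<close> and keep it at the
  rationals \<open>q n\<close> that converge to \<open>?d\<close>, hence lie between them. The direction of the interval depends on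
  the parity of the slice. All \<open>q n\<close> are bounded at once, so that one \<open>\<delta>\<close> works for every
  \<open>\<epsilon>\<close>.
\<close>

lemma generator_slice_null:
  assumes \<xi>: "\<xi> \<in> I" and T: "T \<subseteq> A \<xi>" "\<And>x. x \<in> T \<Longrightarrow> \<lfloor>x\<rfloor> = z"
  shows "\<exists>\<delta>. T - earlier \<delta> \<in> sel_null sel"
proof -
  let ?d = "real_of_int z + e \<xi>"
  have "\<exists>q\<in>\<rat>. ?d < q \<and> q < ?d + inverse (real (Suc n))" for n
    by (rule Rats_dense_in_real) simp
  then obtain q where q: "\<And>n. q n \<in> \<rat>" "\<And>n. ?d < q n" "\<And>n. q n < ?d + inverse (real (Suc n))"
    by metis
  obtain \<delta> where \<delta>: "insert ?d (range q) \<subseteq> earlier \<delta>"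
    using small_sets_bounded[OF regular countable_imp_small, of "insert ?d (range q)"] by auto
  have "T - earlier \<delta> \<in> sel_null sel"
  proof (rule sel_null_if_single_intervals)
    fix \<epsilon> :: real
    assume "\<epsilon> > 0"
    then obtain n where n: "inverse (real (Suc n)) < \<epsilon>"
      using reals_Archimedean by blast
    have dist: "\<bar>q n - ?d\<bar> < \<epsilon>"
      using q(2)[of n] q(3)[of n] n by linarith
    have ab: "sel_less sel ?d x \<longleftrightarrow> even z" "sel_less sel x ?d \<longleftrightarrow> odd z"
      "sel_less sel (q n) x \<longleftrightarrow> odd z" "sel_less sel x (q n) \<longleftrightarrow> even z"
      if x: "x \<in> T - earlier \<delta>" for x
    proof -
      have e: "?d \<in> earlier x" "q n \<in> earlier x"
        using \<delta> x earlier_if_late by blast+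
      have "\<lfloor>x\<rfloor> = z" "?d \<in> exceptions x"
        using x T \<xi> marker_floor_frac[OF \<xi>] by (auto simp: exceptions_def)
      then have "above x ?d \<longleftrightarrow> even z" "above x (q n) \<longleftrightarrow> odd z"
        using rational_not_exception[OF q(1)] by (simp_all add: above_def)
      then show "sel_less sel ?d x \<longleftrightarrow> even z" "sel_less sel x ?d \<longleftrightarrow> odd z"
        "sel_less sel (q n) x \<longleftrightarrow> odd z" "sel_less sel x (q n) \<longleftrightarrow> even z"
        using sel_less_earlier[OF e(1)] sel_less_earlier[OF e(2)] by auto
    qed
    show "\<exists>r s. \<bar>s - r\<bar> < \<epsilon> \<and> T - earlier \<delta> \<subseteq> sel_Ioc sel r s"
    proof (cases "even z")
      case True
      then have "T - earlier \<delta> \<subseteq> sel_Ioc sel ?d (q n)"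
        using ab by (auto simp: sel_Ioc_def sel_le_def)
      then show ?thesis
        using dist by blast
    next
      case False
      then have "T - earlier \<delta> \<subseteq> sel_Ioc sel (q n) ?d"
        using ab by (auto simp: sel_Ioc_def sel_le_def)
      then show ?thesis
        using dist by (metis abs_minus_commute)
    qed
  qed
  then show ?thesis ..
qed

text \<open>
  The odd integer \<open>z\<close> separates an even unit interval on its left from an odd one on its right.
  Hence there are late \<open>p < z < q\<close> arbitrarily close to each other with \<open>p\<close> below and
  \<open>q\<close> above all of \<open>S\<close>; the exceptions of \<open>p\<close> and \<open>q\<close> lie in \<open>[z - 1, z + 1)\<close>, away from \<open>S\<close>.
\<close>

lemma small_avoiding_null:
  assumes "S \<in> small_sets" "odd z" "\<And>x. x \<in> S \<Longrightarrow> \<lfloor>x\<rfloor> \<noteq> z - 1 \<and> \<lfloor>x\<rfloor> \<noteq> z"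
  shows "S \<in> sel_null sel"
proof (rule sel_null_if_single_intervals)
  fix \<epsilon> :: real
  assume "\<epsilon> > 0"
  \<comment> \<open>The bound 1 keeps \<open>p\<close> and \<open>q\<close> in the two unit intervals adjacent to \<open>z\<close>.\<close>
  define h where "h = min 1 (\<epsilon> / 2)"
  have h: "0 < h" "h \<le> 1" "2 * h \<le> \<epsilon>"
    using \<open>\<epsilon> > 0\<close> by (auto simp: h_def)
  obtain \<delta> where \<delta>: "S \<subseteq> earlier \<delta>"
    using small_sets_bounded[OF regular assms(1)] by blast
  obtain p where p: "of_int z - h < p" "p < of_int z" "p \<notin> earlier \<delta>"
    using interval_not_small[OF _ initial_segment_small, of "of_int z - h" "of_int z" \<delta>] h by auto
  obtain q where q: "of_int z < q" "q < of_int z + h" "q \<notin> earlier \<delta>"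
    using interval_not_small[OF _ initial_segment_small, of "of_int z" "of_int z + h" \<delta>] h by auto
  have fl: "\<lfloor>p\<rfloor> = z - 1" "\<lfloor>q\<rfloor> = z"
    using p q h by (auto simp: floor_eq_iff)
  have "x \<in> sel_Ioc sel p q" if x: "x \<in> S" for x
  proof -
    have e: "x \<in> earlier p" "x \<in> earlier q"
      using \<delta> x p(3) q(3) earlier_if_late by blast+
    have "\<not> above p x" "above q x"
      using assms(2) assms(3)[OF x] fl by (auto simp: above_def exceptions_def)
    then show ?thesis
      using sel_less_earlier(2)[OF e(1)] sel_less_earlier(1)[OF e(2)]
      by (auto simp: sel_Ioc_def sel_le_def)
  qed
  moreover have "\<bar>q - p\<bar> < \<epsilon>"
    using p q h by linarith
  ultimately show "\<exists>r s. \<bar>s - r\<bar> < \<epsilon> \<and> S \<subseteq> sel_Ioc sel r s"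
    by blast
qed

text \<open>
  The unit intervals adjacent to 1 and those adjacent to 3 are disjoint, so \<open>S\<close> splits into two
  parts to which the previous lemma applies.
\<close>

lemma small_null:
  assumes "S \<in> small_sets"
  shows "S \<in> sel_null sel"
proof -
  let ?T = "{x. \<lfloor>x\<rfloor> \<in> {0, 1::int}}"
  have "S - ?T \<in> sel_null sel"
    by (rule small_avoiding_null[of _ 1]) (auto intro: small_sets_mono[OF assms])
  moreover have "S \<inter> ?T \<in> sel_null sel"
    by (rule small_avoiding_null[of _ 3]) (auto intro: small_sets_mono[OF assms])
  ultimately have "(S - ?T) \<union> (S \<inter> ?T) \<in> sel_null sel"
    by (rule sel_null_Un)
  then show ?thesis
    by (rule sel_null_subset) blast
qed

text \<open>
  The slices of \<open>A \<xi>\<close> by unit intervals are countably many, and the early points that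
  a slice leaves uncovered form a small set.
\<close>

lemma generator_null:
  assumes "\<xi> \<in> I"
  shows "A \<xi> \<in> sel_null sel"
proof -
  let ?T = "\<lambda>z. {x \<in> A \<xi>. \<lfloor>x\<rfloor> = z}"
  have "?T z \<in> sel_null sel" for z
  proof -
    have "\<exists>\<delta>. ?T z - earlier \<delta> \<in> sel_null sel"
      by (rule generator_slice_null[OF assms]) auto
    then obtain \<delta> where "?T z - earlier \<delta> \<in> sel_null sel" ..
    then have "(?T z - earlier \<delta>) \<union> earlier \<delta> \<in> sel_null sel"
      using small_null[OF initial_segment_small] by (rule sel_null_Un)
    then show ?thesis
      by (rule sel_null_subset) blast
  qed
  then have "(\<Union>z. ?T z) \<in> sel_null sel"
    by (rule sel_null_UN[OF countableI_type])
  then show ?thesis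
    by (rule sel_null_subset) auto
qed

lemma ideal_null:
  assumes "X \<in> ideal_sum small_sets (gen_sigma_ideal (A ` I))"
  shows "X \<in> sel_null sel"
proof -
  from assms obtain S J where SJ: "X = S \<union> J" "S \<in> small_sets" "J \<in> gen_sigma_ideal (A ` I)"
    unfolding ideal_sum_def by (elim CollectE exE conjE)
  from SJ(3) obtain \<B> C where \<B>: "\<B> \<subseteq> A ` I" "countable \<B>"
    and C: "countable C" and J: "J \<subseteq> C \<union> \<Union>\<B>"
    unfolding gen_sigma_ideal_def by (elim CollectE exE conjE)
  have "(\<Union>B\<in>\<B>. B) \<in> sel_null sel"
    using \<B>(1) generator_null by (intro sel_null_UN[OF \<B>(2)]) blast
  then have "\<Union>\<B> \<in> sel_null sel"
    by simp
  then have "S \<union> (C \<union> \<Union>\<B>) \<in> sel_null sel"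
    using small_null[OF SJ(2)] small_null[OF countable_imp_small[OF C]]
    by (intro sel_null_Un)
  then show ?thesis
    by (rule sel_null_subset) (use SJ(1) J in blast)
qed

lemma sel_null_sel: "sel_null sel = ideal_sum small_sets (gen_sigma_ideal (A ` I))"
proof (intro subset_antisym subsetI)
  fix X
  assume "X \<in> sel_null sel"
  then obtain r s :: "nat \<Rightarrow> real" where "X \<subseteq> (\<Union>n. sel_Ioc sel (r n) (s n))"
    using zero_less_one unfolding sel_null_iff by (elim allE[of _ 1] impE exE conjE)
  then show "X \<in> ideal_sum small_sets (gen_sigma_ideal (A ` I))"
    by (rule covered_imp_ideal)
qed (rule ideal_null)

end

theorem theorem1p11:
  fixes \<kappa> :: "'i rel" and A :: "'i \<Rightarrow> real set"
  assumes "Card_order \<kappa>" and "\<kappa> =o |UNIV :: real set|"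
    and "regularCard \<kappa>"
    and "\<And>\<xi>. \<xi> \<in> Field \<kappa> \<Longrightarrow> A \<xi> \<noteq> {}"
    and "\<And>\<xi>. \<xi> \<in> Field \<kappa> \<Longrightarrow>
           |UNIV - (\<Union>\<eta>\<in>underS \<kappa> \<xi>. A \<eta>)| =o |UNIV :: real set|"
    and "(\<Union>\<xi>\<in>Field \<kappa>. A \<xi>) = UNIV"
  shows "\<exists>f. weak_selection f \<and>
           sel_null f = ideal_sum small_sets (gen_sigma_ideal (A ` Field \<kappa>))"
proof -
  let ?W = "|UNIV :: real set|"
  have "Cinfinite \<kappa>"
    using assms(1,2) card_of_ordIso_finite[of "Field \<kappa>" "UNIV :: real set"]
      ordIso_transitive[OF card_of_Field_ordIso[OF assms(1)]]
    by (auto simp: cinfinite_def infinite_UNIV_char_0)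
  then have regular: "regularCard ?W"
    using assms(2,3) regularCard_ordIso by blast
  have "|Field \<kappa>| =o ?W"
    using card_of_Field_ordIso[OF assms(1)] assms(2) ordIso_transitive by blast
  moreover have "?W =o |{0<..<1} - \<rat> :: real set|"
    using interval_minus_small_sets[OF _ countable_imp_small[OF countable_rat], of 0 1]
      ordIso_symmetric by simp
  ultimately have "|Field \<kappa>| =o |{0<..<1} - \<rat> :: real set|"
    by (rule ordIso_transitive)
  then obtain e where "bij_betw e (Field \<kappa>) ({0<..<1} - \<rat> :: real set)"
    using card_of_ordIso by blast
  then interpret marked_selection "Field \<kappa>" A e
    using regular by unfold_locales (auto simp: bij_betw_def)
  show ?thesis
    using weak_selection_sel sel_null_sel by blast
qed

end
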